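(* Let $M$ be a topological space. The cuplength map is a precategory on $M$, that is: $\mathrm{cuplength}(U\cup V)\le\mathrm{cuplength}(U)+\mathrm{cuplength}(V)$ for all open subsets $U,V\subset M$; and if $f:M\to M$ is a continuous map homotopic to $\mathrm{id}_M$, then $\mathrm{cuplength}(A)\le\mathrm{cuplength}(f(A))$ for every subset $A\subset M$. Hence the map $\nu_{CL}:2^M\to\mathbb{Z}\cup\{+\infty\}$ defined by $$\nu_{CL}(A)=\min\{\mathrm{cuplength}(U)\mid U\subset M\text{ open},\ A\subset U\}$$ is a category on $M$.
   Context: $H^*$ is a fixed ordinary cohomology functor with a cup product $\cup$ (e.g. singular cohomology with coefficients in a commutative ring): a homotopy-invariant contravariant functor on pairs of spaces, with long exact sequences of pairs, excision, $H^k(\mathrm{point})=0$ for $k>0$, natural associative cup products, and relative cup products $H^*(X,U)\otimes H^*(X,V)\to H^*(X,U\cup V)$ for open $U,V\subset X$, compatible with the absolute ones. For a subset $A\subset M$ with inclusion $j:A\to M$, $\mathrm{cuplength}(A)$ (the cup length of $A$ in $M$) is the minimum integer $N>0$ such that for all cohomology classes $\alpha_i\in H^{k_i}(M)$, $i=1,\dots,N$, of degrees $k_i\ge1$, the class $(\alpha_1\cup\cdots\cup\alpha_N)|_A=j^*(\alpha_1\cup\cdots\cup\alpha_N)$ is zero; it is $+\infty$ if no such $N$ exists. A category on $M$ is a map $\nu:2^M\to\mathbb{Z}\cup\{+\infty\}$ such that: (i) if $A\subset B$ then $\nu(A)\le\nu(B)$; (ii) $\nu(A\cup B)\le\nu(A)+\nu(B)$;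 (iii) for every $A\subset M$ there is an open set $U\subset M$ with $A\subset U$ and $\nu(A)=\nu(U)$; (iv) if $f:M\to M$ is continuous and homotopic to $\mathrm{id}_M$, then $\nu(A)\le\nu(f(A))$ for every subset $A\subset M$. A precategory is a map defined on the open subsets of $M$ satisfying (ii) and (iv). *)

theory Defs
  imports "HOL-Homology.Homology" "HOL-Library.Extended"
begin

text \<open>
  The data of a cohomology functor with cup product, on the pairs \<open>(X, A)\<close> whose underlying sets
  lie in a type \<open>'a\<close>.  The argument order of \<open>ind\<close> is that of \<^const>\<open>hom_induced\<close>:
  \<open>ind k X A Y B f\<close> is \<open>f\<^sup>* : H\<^sup>k(Y,B) \<rightarrow> H\<^sup>k(X,A)\<close> for a map of pairs
  \<open>f : (X,A) \<rightarrow> (Y,B)\<close>; absolute cohomology is \<open>coh k X {}\<close>; \<open>cbd k X A\<close> is the connecting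
  map \<open>H\<^sup>k(A) \<rightarrow> H\<^sup>k\<^sup>+\<^sup>1(X,A)\<close>.  \<open>cup X k l\<close> is the product
  \<open>H\<^sup>k(X) \<times> H\<^sup>l(X) \<rightarrow> H\<^sup>k\<^sup>+\<^sup>l(X)\<close> and \<open>rcup X U V k l\<close> the relative product
  \<open>H\<^sup>k(X,U) \<times> H\<^sup>l(X,V) \<rightarrow> H\<^sup>k\<^sup>+\<^sup>l(X,U \<union> V)\<close>.

  As for \<^const>\<open>relative_homology_group\<close>, the cohomology groups are abelian groups written
  multiplicatively, so \<open>\<otimes>\<close> is addition of classes and \<open>\<one>\<close> is the zero class.
\<close>

record ('a, 'c) cohomology =
  coh  :: "nat \<Rightarrow> 'a topology \<Rightarrow> 'a set \<Rightarrow> 'c monoid"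
  ind  :: "nat \<Rightarrow> 'a topology \<Rightarrow> 'a set \<Rightarrow> 'a topology \<Rightarrow> 'a set \<Rightarrow> ('a \<Rightarrow> 'a) \<Rightarrow> 'c \<Rightarrow> 'c"
  cbd  :: "nat \<Rightarrow> 'a topology \<Rightarrow> 'a set \<Rightarrow> 'c \<Rightarrow> 'c"
  cup  :: "'a topology \<Rightarrow> nat \<Rightarrow> nat \<Rightarrow> 'c \<Rightarrow> 'c \<Rightarrow> 'c"
  rcup :: "'a topology \<Rightarrow> 'a set \<Rightarrow> 'a set \<Rightarrow> nat \<Rightarrow> nat \<Rightarrow> 'c \<Rightarrow> 'c \<Rightarrow> 'c"

definition pair_map :: "'a topology \<Rightarrow> 'a set \<Rightarrow> 'a topology \<Rightarrow> 'a set \<Rightarrow> ('a \<Rightarrow> 'a) \<Rightarrow> bool" where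
  "pair_map X A Y B f \<longleftrightarrow>
     A \<subseteq> topspace X \<and> B \<subseteq> topspace Y \<and> continuous_map X Y f \<and> f ` A \<subseteq> B"

definition biadditive :: "'c monoid \<Rightarrow> 'c monoid \<Rightarrow> 'c monoid \<Rightarrow> ('c \<Rightarrow> 'c \<Rightarrow> 'c) \<Rightarrow> bool" where
  "biadditive G K L m \<longleftrightarrow>
     (\<forall>a\<in>carrier G. (\<lambda>b. m a b) \<in> hom K L) \<and> (\<forall>b\<in>carrier K. (\<lambda>a. m a b) \<in> hom G L)"

locale ordinary_cohomology =
  fixes H :: "('a, 'c) cohomology"
  assumes coh_comm_group:
      "A \<subseteq> topspace X \<Longrightarrow> comm_group (coh H k X A)"
    and ind_hom:
      "pair_map X A Y B f \<Longrightarrow> ind H k X A Y B f \<in> hom (coh H k Y B) (coh H k X A)"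
    and ind_id:
      "\<lbrakk>A \<subseteq> topspace X; a \<in> carrier (coh H k X A)\<rbrakk> \<Longrightarrow> ind H k X A X A id a = a"
    and ind_compose:
      "\<lbrakk>pair_map X A Y B f; pair_map Y B Z C g; a \<in> carrier (coh H k Z C)\<rbrakk>
       \<Longrightarrow> ind H k X A Z C (g \<circ> f) a = ind H k X A Y B f (ind H k Y B Z C g a)"
    and homotopy_invariance:
      "\<lbrakk>A \<subseteq> topspace X; B \<subseteq> topspace Y; homotopic_with (\<lambda>h. h ` A \<subseteq> B) X Y f g;
        a \<in> carrier (coh H k Y B)\<rbrakk>
       \<Longrightarrow> ind H k X A Y B f a = ind H k X A Y B g a"
    and cbd_hom:
      "A \<subseteq> topspace X
       \<Longrightarrow> cbd H k X A \<in> hom (coh H k (subtopology X A) {}) (coh H (Suc k) X A)"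
    and cbd_natural:
      "\<lbrakk>pair_map X A Y B f; a \<in> carrier (coh H k (subtopology Y B) {})\<rbrakk>
       \<Longrightarrow> cbd H k X A (ind H k (subtopology X A) {} (subtopology Y B) {} f a)
         = ind H (Suc k) X A Y B f (cbd H k Y B a)"
    and exact_relative_0:
      "A \<subseteq> topspace X
       \<Longrightarrow> kernel (coh H 0 X A) (coh H 0 X {}) (ind H 0 X {} X A id) = {\<one>\<^bsub>coh H 0 X A\<^esub>}"
    and exact_relative_Suc:
      "A \<subseteq> topspace X
       \<Longrightarrow> kernel (coh H (Suc k) X A) (coh H (Suc k) X {}) (ind H (Suc k) X {} X A id)
         = cbd H k X A ` carrier (coh H k (subtopology X A) {})"
    and exact_space:
      "A \<subseteq> topspace X
       \<Longrightarrow> kernel (coh H k X {}) (coh H k (subtopology X A) {})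
             (ind H k (subtopology X A) {} X {} id)
         = ind H k X {} X A id ` carrier (coh H k X A)"
    and exact_subspace:
      "A \<subseteq> topspace X
       \<Longrightarrow> kernel (coh H k (subtopology X A) {}) (coh H (Suc k) X A) (cbd H k X A)
         = ind H k (subtopology X A) {} X {} id ` carrier (coh H k X {})"
    and excision:
      "\<lbrakk>A \<subseteq> topspace X; S \<subseteq> A; X closure_of S \<subseteq> X interior_of A\<rbrakk>
       \<Longrightarrow> ind H k (subtopology X (topspace X - S)) (A - S) X A id
           \<in> iso (coh H k X A) (coh H k (subtopology X (topspace X - S)) (A - S))"
    and dimension:
      "\<lbrakk>topspace X = {x}; k > 0\<rbrakk> \<Longrightarrow> trivial_group (coh H k X {})"
    and cup_biadditive:
      "biadditive (coh H k X {}) (coh H l X {}) (coh H (k + l) X {}) (cup H X k l)"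
    and cup_natural:
      "\<lbrakk>continuous_map X Y f; a \<in> carrier (coh H k Y {}); b \<in> carrier (coh H l Y {})\<rbrakk>
       \<Longrightarrow> ind H (k + l) X {} Y {} f (cup H Y k l a b)
         = cup H X k l (ind H k X {} Y {} f a) (ind H l X {} Y {} f b)"
    and cup_assoc:
      "\<lbrakk>a \<in> carrier (coh H k X {}); b \<in> carrier (coh H l X {}); c \<in> carrier (coh H m X {})\<rbrakk>
       \<Longrightarrow> cup H X (k + l) m (cup H X k l a b) c = cup H X k (l + m) a (cup H X l m b c)"
    and rcup_biadditive:
      "\<lbrakk>openin X U; openin X V\<rbrakk>
       \<Longrightarrow> biadditive (coh H k X U) (coh H l X V) (coh H (k + l) X (U \<union> V)) (rcup H X U V k l)"
    and rcup_cup_compatible: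
      "\<lbrakk>openin X U; openin X V; a \<in> carrier (coh H k X U); b \<in> carrier (coh H l X V)\<rbrakk>
       \<Longrightarrow> ind H (k + l) X {} X (U \<union> V) id (rcup H X U V k l a b)
         = cup H X k l (ind H k X {} X U id a) (ind H l X {} X V id b)"

text \<open>
  \<open>iter_cup H X k \<alpha> n\<close> is \<open>\<alpha> 0 \<union> \<dots> \<union> \<alpha> n\<close> (that is, \<open>n + 1\<close> factors), where \<open>\<alpha> i\<close> has
  degree \<open>k i\<close>.
\<close>

primrec iter_cup ::
  "('a, 'c) cohomology \<Rightarrow> 'a topology \<Rightarrow> (nat \<Rightarrow> nat) \<Rightarrow> (nat \<Rightarrow> 'c) \<Rightarrow> nat \<Rightarrow> 'c" where
  "iter_cup H X k \<alpha> 0 = \<alpha> 0"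
| "iter_cup H X k \<alpha> (Suc n) = cup H X (\<Sum>i\<le>n. k i) (k (Suc n)) (iter_cup H X k \<alpha> n) (\<alpha> (Suc n))"

definition cups_vanish_on ::
  "('a, 'c) cohomology \<Rightarrow> 'a topology \<Rightarrow> 'a set \<Rightarrow> nat \<Rightarrow> bool" where
  "cups_vanish_on H M A N \<longleftrightarrow>
     (\<forall>k \<alpha>. (\<forall>i<N. 1 \<le> k i \<and> \<alpha> i \<in> carrier (coh H (k i) M {})) \<longrightarrow>
        ind H (\<Sum>i<N. k i) (subtopology M A) {} M {} id (iter_cup H M k \<alpha> (N - 1))
          = \<one>\<^bsub>coh H (\<Sum>i<N. k i) (subtopology M A) {}\<^esub>)"

definition cuplength :: "('a, 'c) cohomology \<Rightarrow> 'a topology \<Rightarrow> 'a set \<Rightarrow> int extended" where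
  "cuplength H M A =
     (if \<exists>N>0. cups_vanish_on H M A N
      then Fin (int (LEAST N. 0 < N \<and> cups_vanish_on H M A N))
      else Pinf)"

text \<open>
  \<open>\<int> \<union> {+\<infinity>}\<close> is rendered as the type \<open>int extended\<close> without its least element
  \<^const>\<open>Minf\<close>.  Only the values on subsets of \<open>topspace M\<close> matter.
\<close>

definition category_on :: "'a topology \<Rightarrow> ('a set \<Rightarrow> int extended) \<Rightarrow> bool" where
  "category_on M \<nu> \<longleftrightarrow>
     (\<forall>A. A \<subseteq> topspace M \<longrightarrow> \<nu> A \<noteq> Minf) \<and>
     (\<forall>A B. A \<subseteq> B \<and> B \<subseteq> topspace M \<longrightarrow> \<nu> A \<le> \<nu> B) \<and>
     (\<forall>A B. A \<subseteq> topspace M \<and> B \<subseteq> topspace M \<longrightarrow> \<nu> (A \<union> B) \<le> \<nu> A + \<nu> B) \<and>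
     (\<forall>A. A \<subseteq> topspace M \<longrightarrow> (\<exists>U. openin M U \<and> A \<subseteq> U \<and> \<nu> A = \<nu> U)) \<and>
     (\<forall>f A. continuous_map M M f \<and> homotopic_with (\<lambda>_. True) M M f id \<and> A \<subseteq> topspace M
        \<longrightarrow> \<nu> A \<le> \<nu> (f ` A))"

text \<open>
  A precategory is defined on open sets only, so the homotopy condition is imposed where both
  \<open>\<nu> A\<close> and \<open>\<nu> (f ` A)\<close> make sense.
\<close>

definition precategory_on :: "'a topology \<Rightarrow> ('a set \<Rightarrow> int extended) \<Rightarrow> bool" where
  "precategory_on M \<nu> \<longleftrightarrow>
     (\<forall>U. openin M U \<longrightarrow> \<nu> U \<noteq> Minf) \<and>
     (\<forall>U V. openin M U \<and> openin M V \<longrightarrow> \<nu> (U \<union> V) \<le> \<nu> U + \<nu> V) \<and>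
     (\<forall>f A. continuous_map M M f \<and> homotopic_with (\<lambda>_. True) M M f id \<and>
        openin M A \<and> openin M (f ` A) \<longrightarrow> \<nu> A \<le> \<nu> (f ` A))"

definition nu_CL :: "('a, 'c) cohomology \<Rightarrow> 'a topology \<Rightarrow> 'a set \<Rightarrow> int extended" where
  "nu_CL H M A = (LEAST n. \<exists>U. openin M U \<and> A \<subseteq> U \<and> n = cuplength H M U)"

text \<open>The minimum defining \<^const>\<open>nu_CL\<close> exists, so that the \<open>LEAST\<close> is meaningful.\<close>

lemma cuplength_cases: "cuplength H M A = Pinf \<or> (\<exists>n::nat. cuplength H M A = Fin (int n))"
  by (simp add: cuplength_def)

lemma nu_CL_is_minimum:
  assumes "A \<subseteq> topspace M"
  shows "\<exists>U. openin M U \<and> A \<subseteq> U \<and> nu_CL H M A = cuplength H M U"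
    and "\<And>U. \<lbrakk>openin M U; A \<subseteq> U\<rbrakk> \<Longrightarrow> nu_CL H M A \<le> cuplength H M U"
proof -
  define P where "P n \<longleftrightarrow> (\<exists>U. openin M U \<and> A \<subseteq> U \<and> n = cuplength H M U)" for n
  have nu: "nu_CL H M A = (LEAST n. P n)"
    by (simp add: nu_CL_def P_def)
  have P_top: "P (cuplength H M (topspace M))"
    using assms by (auto simp: P_def)
  have P_cases: "n = Pinf \<or> (\<exists>m::nat. n = Fin (int m))" if "P n" for n
    using that cuplength_cases by (auto simp: P_def)
  have "\<exists>n. P n \<and> (\<forall>m. P m \<longrightarrow> n \<le> m)"
  proof (cases "\<exists>m::nat. P (Fin (int m))")
    case True
    then have "P (Fin (int (LEAST m. P (Fin (int m)))))"
      by (metis (mono_tags, lifting) LeastI)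
    moreover have "Fin (int (LEAST m. P (Fin (int m)))) \<le> n" if "P n" for n
      using P_cases[OF that] that by (auto intro: Least_le)
    ultimately show ?thesis by blast
  next
    case False
    then have "n = Pinf" if "P n" for n
      using P_cases[OF that] that by blast
    then show ?thesis using P_top by blast
  qed
  then obtain n where n: "P n" "\<And>m. P m \<Longrightarrow> n \<le> m" by blast
  then have eq: "nu_CL H M A = n"
    unfolding nu by (intro Least_equality) auto
  show "\<exists>U. openin M U \<and> A \<subseteq> U \<and> nu_CL H M A = cuplength H M U"
    using n(1) by (simp add: eq P_def)
  show "nu_CL H M A \<le> cuplength H M U" if "openin M U" "A \<subseteq> U" for U
    using n(2) that by (auto simp: eq P_def)
qed

end

theory Submission
  imports Defs
begin

text \<open>
  If \<open>\<alpha>\<close> vanishes on the open set \<open>U\<close> and \<open>\<beta>\<close> on the open set \<open>V\<close>, exactness lifts them to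
  \<open>H\<^sup>*(M,U)\<close> and \<open>H\<^sup>*(M,V)\<close>; the relative product of the lifts lies in \<open>H\<^sup>*(M, U \<union> V)\<close> and maps to
  \<open>\<alpha> \<union> \<beta>\<close>, which therefore vanishes on \<open>U \<union> V\<close>.  Splitting a product of \<open>N + L\<close> classes into its
  first \<open>N\<close> and last \<open>L\<close> factors gives subadditivity.  If \<open>f \<simeq> id\<close> maps \<open>A\<close> into \<open>B\<close>, then
  \<open>\<omega>|\<^sub>A = (f\<^sup>*\<omega>)|\<^sub>A = (f|\<^sub>A)\<^sup>*(\<omega>|\<^sub>B)\<close>, so classes vanishing on \<open>B\<close> vanish on \<open>A\<close>.
\<close>

section \<open>Cup length as a minimum, possibly infinite\<close>

lemma cuplength_le:
  assumes "0 < N" "cups_vanish_on H M A N"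
  shows "cuplength H M A \<le> Fin (int N)"
proof -
  have "(LEAST N. 0 < N \<and> cups_vanish_on H M A N) \<le> N"
    by (rule Least_le) (use assms in blast)
  then show ?thesis
    using assms by (auto simp: cuplength_def)
qed

lemma cuplength_attained:
  obtains "cuplength H M A = Pinf"
  | N where "0 < N" "cups_vanish_on H M A N" "cuplength H M A = Fin (int N)"
proof (cases "\<exists>N>0. cups_vanish_on H M A N")
  case True
  then have "\<exists>N. 0 < N \<and> cups_vanish_on H M A N" by blast
  from LeastI_ex[OF this] show ?thesis
    using that(2)[of "LEAST N. 0 < N \<and> cups_vanish_on H M A N"] True
    by (auto simp: cuplength_def)
next
  case False
  then show ?thesis using that(1) by (simp add: cuplength_def)
qed

text \<open>The least length that works for \<open>B\<close> is a candidate for \<open>A\<close>; if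
  no length works for \<open>B\<close>, the bound is \<open>Pinf\<close>.\<close>

lemma cuplength_mono_vanish:
  assumes "\<And>N. 0 < N \<Longrightarrow> cups_vanish_on H M B N \<Longrightarrow> cups_vanish_on H M A N"
  shows "cuplength H M A \<le> cuplength H M B"
  by (cases rule: cuplength_attained[of H M B]) (auto intro: cuplength_le assms)

context ordinary_cohomology
begin

section \<open>Products of finitely many classes\<close>

lemma ind_closed:
  assumes "pair_map X A Y B f" "a \<in> carrier (coh H k Y B)"
  shows "ind H k X A Y B f a \<in> carrier (coh H k X A)"
  using ind_hom[OF assms(1)] assms(2) by (rule hom_in_carrier)

lemma cup_closed:
  assumes "a \<in> carrier (coh H k X {})" "b \<in> carrier (coh H l X {})"
  shows "cup H X k l a b \<in> carrier (coh H (k + l) X {})"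
proof -
  have "cup H X k l a \<in> hom (coh H l X {}) (coh H (k + l) X {})"
    using cup_biadditive[of k X l] assms(1) unfolding biadditive_def by blast
  then show ?thesis using assms(2) by (rule hom_in_carrier)
qed

lemma rcup_closed:
  assumes "openin X U" "openin X V" "a \<in> carrier (coh H k X U)" "b \<in> carrier (coh H l X V)"
  shows "rcup H X U V k l a b \<in> carrier (coh H (k + l) X (U \<union> V))"
proof -
  have "rcup H X U V k l a \<in> hom (coh H l X V) (coh H (k + l) X (U \<union> V))"
    using rcup_biadditive[OF assms(1,2), of k l] assms(3) unfolding biadditive_def by blast
  then show ?thesis using assms(4) by (rule hom_in_carrier)
qed

lemma iter_cup_closed:
  assumes "\<And>i. i \<le> n \<Longrightarrow> \<alpha> i \<in> carrier (coh H (k i) X {})"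
  shows "iter_cup H X k \<alpha> n \<in> carrier (coh H (\<Sum>i\<le>n. k i) X {})"
  using assms by (induction n) (auto intro: cup_closed)

text \<open>\<open>iter_cup\<close> nests to the left, so in the induction on \<open>m\<close> the
  newest factor multiplies the whole product from outside; associativity moves it into the right
  block. The blocks have \<open>n + 1\<close> and \<open>m + 1\<close> factors, so neither is empty
  and no unit class enters.\<close>

lemma iter_cup_split:
  assumes "\<And>i. i \<le> Suc (n + m) \<Longrightarrow> \<alpha> i \<in> carrier (coh H (k i) X {})"
  shows "iter_cup H X k \<alpha> (Suc (n + m)) =
    cup H X (\<Sum>i\<le>n. k i) (\<Sum>i\<le>m. k (Suc n + i)) (iter_cup H X k \<alpha> n)
      (iter_cup H X (\<lambda>i. k (Suc n + i)) (\<lambda>i. \<alpha> (Suc n + i)) m)"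
  using assms
proof (induction m)
  case 0
  then show ?case by simp
next
  case (Suc m)
  let ?k = "\<lambda>i. k (Suc n + i)" and ?\<alpha> = "\<lambda>i. \<alpha> (Suc n + i)"
  \<comment> \<open>Degrees are arguments of \<open>cup\<close>, so \<open>cup_assoc\<close> matches
    only once the total degree is displayed as the sum of the two block degrees.\<close>
  have degree: "(\<Sum>i\<le>Suc (n + m). k i) = (\<Sum>i\<le>n. k i) + (\<Sum>i\<le>m. ?k i)"
    by (induction m) auto
  have "iter_cup H X k \<alpha> (Suc (n + Suc m)) =
    cup H X ((\<Sum>i\<le>n. k i) + (\<Sum>i\<le>m. ?k i)) (?k (Suc m))
      (cup H X (\<Sum>i\<le>n. k i) (\<Sum>i\<le>m. ?k i) (iter_cup H X k \<alpha> n) (iter_cup H X ?k ?\<alpha> m))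
      (?\<alpha> (Suc m))"
    unfolding add_Suc_right iter_cup.simps(2)[of H X k \<alpha> "Suc (n + m)"] degree
    using Suc by simp
  also have "\<dots> = cup H X (\<Sum>i\<le>n. k i) ((\<Sum>i\<le>m. ?k i) + ?k (Suc m)) (iter_cup H X k \<alpha> n)
      (cup H X (\<Sum>i\<le>m. ?k i) (?k (Suc m)) (iter_cup H X ?k ?\<alpha> m) (?\<alpha> (Suc m)))"
    by (intro cup_assoc iter_cup_closed Suc.prems) auto
  finally show ?case by simp
qed

section \<open>Subadditivity on open sets\<close>

lemma cup_vanishes_on_Un:
  assumes U: "openin X U" and V: "openin X V"
    and a: "a \<in> carrier (coh H k X {})"
    and b: "b \<in> carrier (coh H l X {})"
    and aU: "ind H k (subtopology X U) {} X {} id a = \<one>\<^bsub>coh H k (subtopology X U) {}\<^esub>"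
    and bV: "ind H l (subtopology X V) {} X {} id b = \<one>\<^bsub>coh H l (subtopology X V) {}\<^esub>"
  shows "ind H (k + l) (subtopology X (U \<union> V)) {} X {} id (cup H X k l a b)
    = \<one>\<^bsub>coh H (k + l) (subtopology X (U \<union> V)) {}\<^esub>"
proof -
  have top: "U \<subseteq> topspace X" "V \<subseteq> topspace X" "U \<union> V \<subseteq> topspace X"
    using U V by (auto dest: openin_subset)
  obtain a' where a': "a' \<in> carrier (coh H k X U)" "a = ind H k X {} X U id a'"
    using exact_space[OF top(1), of k] a aU unfolding kernel_def by blast
  obtain b' where b': "b' \<in> carrier (coh H l X V)" "b = ind H l X {} X V id b'"
    using exact_space[OF top(2), of l] b bV unfolding kernel_def by blast
  have "cup H X k l a b = ind H (k + l) X {} X (U \<union> V) id (rcup H X U V k l a' b')"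
    using rcup_cup_compatible[OF U V a'(1) b'(1)] a'(2) b'(2) by simp
  moreover have "rcup H X U V k l a' b' \<in> carrier (coh H (k + l) X (U \<union> V))"
    using rcup_closed[OF U V a'(1) b'(1)] .
  \<comment> \<open>Exactness is now read in the other direction: a class coming from the pair
    \<open>(X, U \<union> V)\<close> restricts to zero on the union.\<close>
  ultimately show ?thesis
    using exact_space[OF top(3), of "k + l"] unfolding kernel_def by blast
qed

lemma cups_vanish_on_Un:
  assumes U: "openin M U" and V: "openin M V" and N: "0 < N" and L: "0 < L"
    and vU: "cups_vanish_on H M U N" and vV: "cups_vanish_on H M V L"
  shows "cups_vanish_on H M (U \<union> V) (N + L)"
  unfolding cups_vanish_on_def
proof (intro allI impI)
  fix k \<alpha>
  assume \<alpha>: "\<forall>i<N + L. 1 \<le> k i \<and> \<alpha> i \<in> carrier (coh H (k i) M {})"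
  \<comment> \<open>\<open>iter_cup\<close> is indexed by its last factor, so a product of
    \<open>N\<close> classes sits at index \<open>n = N - 1\<close>, and one of \<open>L\<close>
    classes at \<open>m = L - 1\<close>.\<close>
  obtain n m where nm: "N = Suc n" "L = Suc m"
    using N L gr0_implies_Suc by metis
  let ?k = "\<lambda>i. k (Suc n + i)" and ?\<alpha> = "\<lambda>i. \<alpha> (Suc n + i)"
  have degree: "(\<Sum>i<N + L. k i) = (\<Sum>i\<le>n. k i) + (\<Sum>i\<le>m. ?k i)"
    unfolding nm by (induction m) (auto simp: lessThan_Suc_atMost)
  have "ind H (\<Sum>i\<le>n. k i) (subtopology M U) {} M {} id (iter_cup H M k \<alpha> n)
      = \<one>\<^bsub>coh H (\<Sum>i\<le>n. k i) (subtopology M U) {}\<^esub>"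
    using vU[unfolded cups_vanish_on_def nm, rule_format, of k \<alpha>] \<alpha>
    by (simp add: nm lessThan_Suc_atMost)
  \<comment> \<open>Vanishing on \<open>V\<close> concerns arbitrary families of classes; here it is
    applied to the last \<open>L\<close> of them, reindexed from 0.\<close>
  moreover have "ind H (\<Sum>i\<le>m. ?k i) (subtopology M V) {} M {} id (iter_cup H M ?k ?\<alpha> m)
      = \<one>\<^bsub>coh H (\<Sum>i\<le>m. ?k i) (subtopology M V) {}\<^esub>"
    using vV[unfolded cups_vanish_on_def nm, rule_format, of ?k ?\<alpha>] \<alpha>
    by (simp add: nm lessThan_Suc_atMost)
  moreover have "iter_cup H M k \<alpha> n \<in> carrier (coh H (\<Sum>i\<le>n. k i) M {})"
    "iter_cup H M ?k ?\<alpha> m \<in> carrier (coh H (\<Sum>i\<le>m. ?k i) M {})"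
    using iter_cup_closed[of n \<alpha> k M] iter_cup_closed[of m ?\<alpha> ?k M] \<alpha> nm by simp_all
  moreover have "iter_cup H M k \<alpha> (N + L - 1) =
    cup H M (\<Sum>i\<le>n. k i) (\<Sum>i\<le>m. ?k i) (iter_cup H M k \<alpha> n) (iter_cup H M ?k ?\<alpha> m)"
    using iter_cup_split[of n m \<alpha> k M] \<alpha> nm by simp
  ultimately show "ind H (\<Sum>i<N + L. k i) (subtopology M (U \<union> V)) {} M {} id
      (iter_cup H M k \<alpha> (N + L - 1)) = \<one>\<^bsub>coh H (\<Sum>i<N + L. k i) (subtopology M (U \<union> V)) {}\<^esub>"
    unfolding degree by (simp only: cup_vanishes_on_Un[OF U V])
qed

lemma cuplength_Un:
  assumes "openin M U" "openin M V"
  shows "cuplength H M (U \<union> V) \<le> cuplength H M U + cuplength H M V"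
proof (cases rule: cuplength_attained[of H M U])
  case 1
  then show ?thesis by (cases rule: cuplength_attained[of H M V]) auto
next
  case U: (2 N)
  show ?thesis
  proof (cases rule: cuplength_attained[of H M V])
    case 1
    then show ?thesis by (simp add: U)
  next
    case V: (2 L)
    then show ?thesis
      using cuplength_le[OF _ cups_vanish_on_Un[OF assms U(1) V(1) U(2) V(2)]] U by simp
  qed
qed

section \<open>Monotonicity under maps homotopic to the identity\<close>

lemma restriction_factors:
  assumes f: "homotopic_with (\<lambda>_. True) M M f id" and A: "A \<subseteq> topspace M" "f ` A \<subseteq> B"
    and w: "w \<in> carrier (coh H k M {})"
  shows "ind H k (subtopology M A) {} M {} id w =
    ind H k (subtopology M A) {} (subtopology M B) {} f (ind H k (subtopology M B) {} M {} id w)"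
proof -
  have cont: "continuous_map M M f"
    using f by (rule homotopic_with_imp_continuous_maps[THEN conjunct1])
  have incl: "pair_map (subtopology M S) {} M {} id" for S
    unfolding pair_map_def by (simp add: continuous_map_from_subtopology)
  \<comment> \<open>With empty second components, the condition on the stages of a homotopy of pairs
    is trivial.\<close>
  have "ind H k M {} M {} f w = w"
    using homotopy_invariance[of "{}" M "{}" M f id w k] f ind_id[of "{}" M w k] w by simp
  then have "ind H k (subtopology M A) {} M {} id w
      = ind H k (subtopology M A) {} M {} id (ind H k M {} M {} f w)" by simp
  also have "\<dots> = ind H k (subtopology M A) {} M {} (f \<circ> id) w"
    using cont w by (intro ind_compose[OF incl, symmetric]) (auto simp: pair_map_def)
  also have "\<dots> = ind H k (subtopology M A) {} M {} (id \<circ> f) w" by simp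
  also have "\<dots> = ind H k (subtopology M A) {} (subtopology M B) {} f
      (ind H k (subtopology M B) {} M {} id w)"
    using cont A w
    by (intro ind_compose[OF _ incl])
      (auto simp: pair_map_def continuous_map_in_subtopology continuous_map_from_subtopology)
  finally show ?thesis .
qed

text \<open>Allowing any \<open>B\<close> that contains the image of \<open>A\<close> makes this
  applicable to the preimage of an open set, whose image may be smaller than that set.\<close>

lemma cuplength_le_of_homotopic_id:
  assumes f: "homotopic_with (\<lambda>_. True) M M f id" and A: "A \<subseteq> topspace M" "f ` A \<subseteq> B"
  shows "cuplength H M A \<le> cuplength H M B"
proof (rule cuplength_mono_vanish)
  fix N :: nat
  assume N: "0 < N" and B: "cups_vanish_on H M B N"
  show "cups_vanish_on H M A N"
    unfolding cups_vanish_on_def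
  proof (intro allI impI)
    fix k \<alpha>
    assume \<alpha>: "\<forall>i<N. 1 \<le> k i \<and> \<alpha> i \<in> carrier (coh H (k i) M {})"
    let ?d = "\<Sum>i<N. k i" and ?w = "iter_cup H M k \<alpha> (N - 1)"
    let ?A = "subtopology M A" and ?B = "subtopology M B"
    \<comment> \<open>Positivity of \<open>N\<close> reconciles the range \<open>i < N\<close> in
      \<open>cups_vanish_on\<close> with the range \<open>i \<le> N - 1\<close> in
      \<open>iter_cup_closed\<close>.\<close>
    have "{..N - 1} = {..<N}" using N by auto
    then have w: "?w \<in> carrier (coh H ?d M {})"
      using iter_cup_closed[of "N - 1" \<alpha> k M] \<alpha> N by auto
    have "continuous_map M M f"
      using f by (rule homotopic_with_imp_continuous_maps[THEN conjunct1])
    then have "pair_map ?A {} ?B {} f"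
      using A by (auto simp: pair_map_def continuous_map_in_subtopology
          continuous_map_from_subtopology)
    then have "ind H ?d ?A {} ?B {} f \<in> hom (coh H ?d ?B {}) (coh H ?d ?A {})"
      by (rule ind_hom)
    then have "ind H ?d ?A {} ?B {} f \<one>\<^bsub>coh H ?d ?B {}\<^esub> = \<one>\<^bsub>coh H ?d ?A {}\<^esub>"
      by (rule hom_one) (auto intro!: comm_group.axioms(2) coh_comm_group)
    then show "ind H ?d ?A {} M {} id ?w = \<one>\<^bsub>coh H ?d ?A {}\<^esub>"
      using restriction_factors[OF f A w] B \<alpha> unfolding cups_vanish_on_def by simp
  qed
qed

section \<open>From open sets to arbitrary subsets\<close>

lemma nu_CL_Un:
  assumes "A \<subseteq> topspace M" "B \<subseteq> topspace M"
  shows "nu_CL H M (A \<union> B) \<le> nu_CL H M A + nu_CL H M B"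
proof -
  obtain U V where U: "openin M U" "A \<subseteq> U" "nu_CL H M A = cuplength H M U"
    and V: "openin M V" "B \<subseteq> V" "nu_CL H M B = cuplength H M V"
    using nu_CL_is_minimum(1) assms by metis
  \<comment> \<open>The union of the two optimal neighbourhoods competes in the minimum for
    \<open>A \<union> B\<close>.\<close>
  have "nu_CL H M (A \<union> B) \<le> cuplength H M (U \<union> V)"
    using U V assms by (intro nu_CL_is_minimum(2)) auto
  also have "\<dots> \<le> nu_CL H M A + nu_CL H M B"
    using cuplength_Un[OF U(1) V(1)] U(3) V(3) by simp
  finally show ?thesis .
qed

lemma nu_CL_homotopic_id:
  assumes f: "homotopic_with (\<lambda>_. True) M M f id" and A: "A \<subseteq> topspace M"
  shows "nu_CL H M A \<le> nu_CL H M (f ` A)"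
proof -
  have cont: "continuous_map M M f"
    using f by (rule homotopic_with_imp_continuous_maps[THEN conjunct1])
  then have "f ` A \<subseteq> topspace M"
    using A by (auto dest: continuous_map_image_subset_topspace)
  then obtain U where U: "openin M U" "f ` A \<subseteq> U" "nu_CL H M (f ` A) = cuplength H M U"
    using nu_CL_is_minimum(1)[of "f ` A" M H] by blast
  \<comment> \<open>Images of open sets need not be open, so the optimal neighbourhood of the image
    is pulled back to an open neighbourhood of \<open>A\<close>.\<close>
  let ?W = "{x \<in> topspace M. f x \<in> U}"
  have "nu_CL H M A \<le> cuplength H M ?W"
    using A U(2) by (intro nu_CL_is_minimum(2) openin_continuous_map_preimage[OF cont U(1)]) auto
  also have "\<dots> \<le> cuplength H M U"
    by (rule cuplength_le_of_homotopic_id[OF f]) auto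
  finally show ?thesis using U(3) by simp
qed

end

lemma nu_CL_mono:
  assumes "A \<subseteq> B" "B \<subseteq> topspace M"
  shows "nu_CL H M A \<le> nu_CL H M B"
proof -
  obtain U where "openin M U" "B \<subseteq> U" "nu_CL H M B = cuplength H M U"
    using nu_CL_is_minimum(1)[OF assms(2)] by blast
  then show ?thesis
    using nu_CL_is_minimum(2)[of A M U H] assms by auto
qed

text \<open>An optimal open \<open>U\<close> around \<open>A\<close> is also a neighbourhood of
  itself, so \<open>nu_CL\<close> at \<open>U\<close> is at most its cup length, which is the value
  at \<open>A\<close>; monotonicity gives the reverse inequality.\<close>

lemma nu_CL_outer_open:
  assumes "A \<subseteq> topspace M"
  shows "\<exists>U. openin M U \<and> A \<subseteq> U \<and> nu_CL H M A = nu_CL H M U"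
proof -
  obtain U where U: "openin M U" "A \<subseteq> U" "nu_CL H M A = cuplength H M U"
    using nu_CL_is_minimum(1)[OF assms] by blast
  then have "U \<subseteq> topspace M" by (simp add: openin_subset)
  then have "nu_CL H M A = nu_CL H M U"
    using nu_CL_mono[OF U(2), of M H] nu_CL_is_minimum(2)[of U M U H] U by simp
  then show ?thesis using U by blast
qed

theorem mainTheorem2:
  fixes H :: "('a, 'c) cohomology" and M :: "'a topology"
  assumes "ordinary_cohomology H"
  shows "precategory_on M (cuplength H M) \<and>
    (\<forall>U V. openin M U \<and> openin M V \<longrightarrow>
       cuplength H M (U \<union> V) \<le> cuplength H M U + cuplength H M V) \<and>
    (\<forall>f A. continuous_map M M f \<and> homotopic_with (\<lambda>_. True) M M f id \<and> A \<subseteq> topspace M \<longrightarrow>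
       cuplength H M A \<le> cuplength H M (f ` A)) \<and>
    category_on M (nu_CL H M)"
proof -
  interpret ordinary_cohomology H by fact
  have not_Minf: "cuplength H M A \<noteq> Minf" for A
    using cuplength_cases[of H M A] by auto
  then have nu_not_Minf: "nu_CL H M A \<noteq> Minf" if "A \<subseteq> topspace M" for A
    using nu_CL_is_minimum(1)[OF that, of H] by metis
  have htpy: "cuplength H M A \<le> cuplength H M (f ` A)"
    if "homotopic_with (\<lambda>_. True) M M f id" "A \<subseteq> topspace M" for f A
    using cuplength_le_of_homotopic_id[OF that] by blast
  have "precategory_on M (cuplength H M)"
    unfolding precategory_on_def by (auto intro: htpy cuplength_Un dest: openin_subset simp: not_Minf)
  moreover have "category_on M (nu_CL H M)"
    unfolding category_on_def
    by (auto intro: nu_CL_mono nu_CL_Un nu_CL_outer_open nu_CL_homotopic_id simp: nu_not_Minf)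
  ultimately show ?thesis
    by (auto intro: htpy cuplength_Un)
qed

end
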